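(* Let $G=(V,E)$, $V=\{1,\dots,n\}$, be an undirected graph which is bidirectional and connected, and for each $(i,j)\in E$ let $q_{d_{ij}}\in\hat{\mathbb{U}}$ be a unit dual quaternion (the desired relative configuration from $i$ to $j$). The desired relative configurations $\{q_{d_{ij}}:(i,j)\in E\}$ are reasonable if and only if (a) for all $(i,j)\in E$, $q_{d_{ji}}=q_{d_{ij}}^*$; and (b) for any cycle $\{j_1,\dots,j_k\}$ of $G$, with $j_{k+1}=j_1$, $\prod_{i=1}^k q_{d_{j_ij_{i+1}}}=1$. Furthermore, let $\mathbf{q}_0\in\hat{\mathbb{U}}^{n\times 1}$ be a desired formation satisfying $q_{d_{ij}}=q_{d_i}^*q_{d_j}$ for all $(i,j)\in E$ (where $q_{d_1},\dots,q_{d_n}$ denote the components of the formation). Then the set of all desired formations in $\hat{\mathbb{U}}^{n\times1}$ satisfying these relations is $$\{c\,\mathbf{q}_0 : c\in\hat{\mathbb{U}}\}.$$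
   Context: A dual quaternion is $q=q_s+q_d\epsilon$ with $q_s,q_d$ (real) quaternions, where $\epsilon^2=0$, $\epsilon\neq 0$, and $\epsilon$ commutes with quaternions. Its conjugate is $q^*=q_s^*+q_d^*\epsilon$. Its magnitude is the dual number $|q|=|q_s|+\frac{q_sq_d^*+q_dq_s^*}{2|q_s|}\epsilon$ if $q_s\ne0$, and $|q|=|q_d|\epsilon$ otherwise. $\hat{\mathbb{U}}$ is the set of unit dual quaternions, i.e. those with $|q|=1$; equivalently $q_s$ is a unit quaternion and $q_sq_d^*+q_dq_s^*=0$; for these $q^{-1}=q^*$. The edge set $E$ consists of ordered pairs $(i,j)$ of distinct nodes; bidirectional means $(i,j)\in E$ if and only if $(j,i)\in E$; connected means that for any two nodes $i,j$ either $(i,j)\in E$ or there are nodes $i_1,\dots,i_k$ with $(i,i_1),\dots,(i_k,j)\in E$. A cycle $\{j_1,\dots,j_k\}$ (with $j_{k+1}=j_1$) is a cyclic sequence of distinct nodes, $k\ge3$, with $(j_i,j_{i+1})\in E$ for $i=1,\dots,k$. The product in (b) is taken in order, $q_{d_{j_1j_2}}q_{d_{j_2j_3}}\cdots q_{d_{j_kj_1}}$. The desired relative configurations $\{q_{d_{ij}}:(i,j)\in E\}\subset\hat{\mathbb{U}}$ are called reasonable if there is a desired formation $\mathbf{q}_d=(q_{d_1},\dots,q_{d_n})^\top\in\hat{\mathbb{U}}^{n\times1}$ such that $q_{d_{ij}}=q_{d_i}^*q_{d_j}$ for all $(i,j)\in E$. For $c\in\hat{\mathbb{U}}$, $c\,\mathbf{q}$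 is componentwise left multiplication by $c$. *)

theory Defs
  imports "HOL-Analysis.Analysis"
begin

datatype quat = Quat (q_re: real) (q_i: real) (q_j: real) (q_k: real)

lemma quat_eq_iff:
  "x = y \<longleftrightarrow> q_re x = q_re y \<and> q_i x = q_i y \<and> q_j x = q_j y \<and> q_k x = q_k y"
  by (cases x; cases y) simp

instantiation quat :: real_vector
begin

definition "0 = Quat 0 0 0 0"
definition "x + y = Quat (q_re x + q_re y) (q_i x + q_i y) (q_j x + q_j y) (q_k x + q_k y)"
definition "- x = Quat (- q_re x) (- q_i x) (- q_j x) (- q_k x)"
definition "x - y = Quat (q_re x - q_re y) (q_i x - q_i y) (q_j x - q_j y) (q_k x - q_k y)"
definition "r *\<^sub>R x = Quat (r * q_re x) (r * q_i x) (r * q_j x) (r * q_k x)"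

instance
  by standard (simp_all add: quat_eq_iff zero_quat_def plus_quat_def uminus_quat_def
      minus_quat_def scaleR_quat_def algebra_simps)

end

lemma quat_sel [simp]:
  "q_re 0 = 0" "q_i 0 = 0" "q_j 0 = 0" "q_k 0 = 0"
  "q_re (x + y) = q_re x + q_re y" "q_i (x + y) = q_i x + q_i y"
  "q_j (x + y) = q_j x + q_j y" "q_k (x + y) = q_k x + q_k y"
  "q_re (- x) = - q_re x" "q_i (- x) = - q_i x" "q_j (- x) = - q_j x" "q_k (- x) = - q_k x"
  "q_re (x - y) = q_re x - q_re y" "q_i (x - y) = q_i x - q_i y"
  "q_j (x - y) = q_j x - q_j y" "q_k (x - y) = q_k x - q_k y"
  "q_re (r *\<^sub>R x) = r * q_re x" "q_i (r *\<^sub>R x) = r * q_i x"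
  "q_j (r *\<^sub>R x) = r * q_j x" "q_k (r *\<^sub>R x) = r * q_k x"
  by (simp_all add: zero_quat_def plus_quat_def uminus_quat_def minus_quat_def scaleR_quat_def)

instantiation quat :: real_inner
begin

definition "x \<bullet> y = q_re x * q_re y + q_i x * q_i y + q_j x * q_j y + q_k x * q_k y"
definition "norm (x::quat) = sqrt (x \<bullet> x)"
definition "dist (x::quat) y = norm (x - y)"
definition "sgn (x::quat) = x /\<^sub>R norm x"
definition "(uniformity :: (quat \<times> quat) filter) = (INF e\<in>{0<..}. principal {(x, y). dist x y < e})"
definition "open (U :: quat set) \<longleftrightarrow>
  (\<forall>x\<in>U. \<forall>\<^sub>F (x', y) in uniformity. x' = x \<longrightarrow> y \<in> U)"

instance
proof
  fix x :: quat
  show "0 \<le> x \<bullet> x"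
    by (simp add: inner_quat_def)
  have "x \<bullet> x = (q_re x)\<^sup>2 + (q_i x)\<^sup>2 + (q_j x)\<^sup>2 + (q_k x)\<^sup>2"
    by (simp add: inner_quat_def power2_eq_square)
  then show "x \<bullet> x = 0 \<longleftrightarrow> x = 0"
    by (simp add: quat_eq_iff add_nonneg_eq_0_iff)
qed (auto simp: inner_quat_def norm_quat_def dist_quat_def sgn_quat_def
    uniformity_quat_def open_quat_def algebra_simps)

end

definition qconj :: "quat \<Rightarrow> quat" where
  "qconj x = Quat (q_re x) (- q_i x) (- q_j x) (- q_k x)"

lemma qconj_sel [simp]:
  "q_re (qconj x) = q_re x" "q_i (qconj x) = - q_i x"
  "q_j (qconj x) = - q_j x" "q_k (qconj x) = - q_k x"
  by (simp_all add: qconj_def)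

instantiation quat :: real_normed_div_algebra
begin

definition "1 = Quat 1 0 0 0"

definition "x * y = Quat
  (q_re x * q_re y - q_i x * q_i y - q_j x * q_j y - q_k x * q_k y)
  (q_re x * q_i y + q_i x * q_re y + q_j x * q_k y - q_k x * q_j y)
  (q_re x * q_j y - q_i x * q_k y + q_j x * q_re y + q_k x * q_i y)
  (q_re x * q_k y + q_i x * q_j y - q_j x * q_i y + q_k x * q_re y)"

definition "inverse x = qconj x /\<^sub>R (x \<bullet> x)"
definition "(x::quat) div y = x * inverse y"

instance
proof
  fix x y :: quat
  show "norm (x * y) = norm x * norm y"
    by (simp add: norm_quat_def inner_quat_def times_quat_def real_sqrt_mult [symmetric]
        algebra_simps)
  assume "x \<noteq> 0"
  then have nz: "x \<bullet> x \<noteq> 0"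
    by simp
  have "qconj x * x = (x \<bullet> x) *\<^sub>R 1" "x * qconj x = (x \<bullet> x) *\<^sub>R 1"
    by (simp_all add: quat_eq_iff times_quat_def one_quat_def inner_quat_def)
  moreover have "inverse x * x = (qconj x * x) /\<^sub>R (x \<bullet> x)"
    "x * inverse x = (x * qconj x) /\<^sub>R (x \<bullet> x)"
    by (simp_all add: inverse_quat_def quat_eq_iff times_quat_def algebra_simps)
  ultimately show "inverse x * x = 1" "x * inverse x = 1"
    using nz by simp_all
qed (simp_all add: quat_eq_iff one_quat_def times_quat_def divide_quat_def inverse_quat_def
    algebra_simps)

end

lemma of_real_quat: "of_real r = Quat r 0 0 0"
  by (simp add: of_real_def quat_eq_iff one_quat_def)

text \<open>
  \<open>Dual a b\<close> is \<open>a + b \<epsilon>\<close>, where \<open>\<epsilon>\<close> is central with square zero. Dual quaternions are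
  \<open>quat dual\<close>, dual numbers are \<open>real dual\<close>.
\<close>

datatype 'a dual = Dual (std_part: 'a) (dual_part: 'a)

lemma dual_eq_iff: "x = y \<longleftrightarrow> std_part x = std_part y \<and> dual_part x = dual_part y"
  by (cases x; cases y) simp

instantiation dual :: (ring_1) ring_1
begin

definition "0 = Dual 0 0"
definition "1 = Dual 1 0"
definition "x + y = Dual (std_part x + std_part y) (dual_part x + dual_part y)"
definition "- x = Dual (- std_part x) (- dual_part x)"
definition "x - y = Dual (std_part x - std_part y) (dual_part x - dual_part y)"
definition "x * y = Dual (std_part x * std_part y)
  (std_part x * dual_part y + dual_part x * std_part y)"

instance
  by standard (simp_all add: dual_eq_iff zero_dual_def one_dual_def plus_dual_def
      uminus_dual_def minus_dual_def times_dual_def algebra_simps)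

end

definition dual_eps :: "'a::ring_1 dual" where
  "dual_eps = Dual 0 1"

lemma
  shows dual_eps_nonzero: "dual_eps \<noteq> (0 :: 'a::ring_1 dual)"
    and dual_eps_square: "dual_eps * dual_eps = (0 :: 'a dual)"
    and dual_eps_commutes: "dual_eps * x = x * (dual_eps :: 'a dual)"
    and Dual_eq: "Dual a b = Dual a 0 + Dual b 0 * (dual_eps :: 'a dual)"
  by (simp_all add: dual_eps_def dual_eq_iff zero_dual_def plus_dual_def times_dual_def)

definition dqconj :: "quat dual \<Rightarrow> quat dual" where
  "dqconj q = Dual (qconj (std_part q)) (qconj (dual_part q))"

text \<open>
  The numerator of the dual part of the magnitude is a real quaternion; taking its real part
  makes the magnitude a dual number.
\<close>

lemma magnitude_numerator_real:
  "of_real (q_re (a * qconj b + b * qconj a)) = a * qconj b + b * qconj a"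
  by (simp add: quat_eq_iff of_real_quat times_quat_def algebra_simps)

definition dq_magnitude :: "quat dual \<Rightarrow> real dual" where
  "dq_magnitude q = (let a = std_part q; b = dual_part q in
     if a \<noteq> 0 then Dual (norm a) (q_re (a * qconj b + b * qconj a) / (2 * norm a))
     else Dual 0 (norm b))"

definition unit_dq :: "quat dual set" where
  "unit_dq = {q. dq_magnitude q = 1}"

lemma unit_dq_iff:
  "q \<in> unit_dq \<longleftrightarrow> norm (std_part q) = 1 \<and>
     std_part q * qconj (dual_part q) + dual_part q * qconj (std_part q) = 0"
proof -
  have "q_re (a * qconj b + b * qconj a) = 0 \<longleftrightarrow> a * qconj b + b * qconj a = 0" for a b
    using magnitude_numerator_real [of a b] of_real_eq_0_iff by metis
  then show ?thesis
    by (auto simp: unit_dq_def dq_magnitude_def one_dual_def Let_def)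
qed

text \<open>
  The nodes are the elements of the finite type \<^typ>\<open>'n\<close>, the edges form a set of ordered
  pairs, and \<open>qd i j\<close> is the desired relative configuration from \<open>i\<close> to \<open>j\<close>; only its values
  on edges matter.
\<close>

definition desired_formations ::
    "('n::finite \<times> 'n) set \<Rightarrow> ('n \<Rightarrow> 'n \<Rightarrow> quat dual) \<Rightarrow> (quat dual ^ 'n) set" where
  "desired_formations E qd =
     {q. (\<forall>i. q $ i \<in> unit_dq) \<and> (\<forall>(i, j)\<in>E. qd i j = dqconj (q $ i) * q $ j)}"

definition reasonable :: "('n::finite \<times> 'n) set \<Rightarrow> ('n \<Rightarrow> 'n \<Rightarrow> quat dual) \<Rightarrow> bool" where
  "reasonable E qd \<longleftrightarrow> (\<exists>q. q \<in> desired_formations E qd)"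

text \<open>Indices are taken modulo the length, so the last node is followed by the first.\<close>

definition is_cycle :: "('n \<times> 'n) set \<Rightarrow> 'n list \<Rightarrow> bool" where
  "is_cycle E js \<longleftrightarrow> 3 \<le> length js \<and> distinct js \<and>
     (\<forall>i<length js. (js ! i, js ! (Suc i mod length js)) \<in> E)"

definition cycle_prod :: "('n \<Rightarrow> 'n \<Rightarrow> 'a::monoid_mult) \<Rightarrow> 'n list \<Rightarrow> 'a" where
  "cycle_prod qd js = (\<Prod>i\<leftarrow>[0..<length js]. qd (js ! i) (js ! (Suc i mod length js)))"

end

theory Submission
  imports Defs
begin

text \<open>
  Condition (b) extends from cycles to all closed walks: a closed walk that is not a cycle
  either backtracks along a single edge, where (a) applies, or repeats an inner node and
  splits into two shorter closed walks. Hence the product along a walk from a fixed root to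
  \<open>j\<close> depends only on \<open>j\<close>, and these products form a desired formation. Two formations
  \<open>q\<close>, \<open>q\<^sub>0\<close> have the same relative configurations, so \<open>q\<^sub>i q\<^sub>0\<^sub>i\<^sup>*\<close> is constant along edges.
\<close>

section \<open>Products along walks\<close>

abbreviation walk :: "('n \<times> 'n) set \<Rightarrow> 'n list \<Rightarrow> bool" where
  "walk E \<equiv> successively (\<lambda>x y. (x, y) \<in> E)"

text \<open>Unlike in \<open>cycle_prod\<close>, nothing wraps around: a closed walk lists its start
  again at the end. Lists with fewer than two nodes give the empty product.\<close>

fun walk_prod :: "('n \<Rightarrow> 'n \<Rightarrow> 'a::monoid_mult) \<Rightarrow> 'n list \<Rightarrow> 'a" where
  "walk_prod g (x # y # w) = g x y * walk_prod g (y # w)"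
| "walk_prod g w = 1"

lemma walk_prod_append: "walk_prod g (u @ x # v) = walk_prod g (u @ [x]) * walk_prod g (x # v)"
proof (induction u)
  case (Cons y u)
  then show ?case
    by (cases u) (simp_all add: mult.assoc)
qed simp

lemma walk_append: "walk E (u @ x # v) \<longleftrightarrow> walk E (u @ [x]) \<and> walk E (x # v)"
  by (auto simp: successively_append_iff)

text \<open>Bridge from the recursion, suited to induction, to the indexed form of
  \<open>cycle_prod\<close>. Truncated subtraction covers the empty list.\<close>

lemma walk_prod_conv_nth:
  "walk_prod g w = (\<Prod>i\<leftarrow>[0..<length w - 1]. g (w ! i) (w ! Suc i))"
proof (induction g w rule: walk_prod.induct)
  case (1 g x y w)
  have "[0..<length (x # y # w) - 1] = 0 # map Suc [0..<length (y # w) - 1]"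
    by (simp add: upt_conv_Cons map_Suc_upt del: upt_Suc)
  then show ?case
    using 1 by (simp add: comp_def del: upt_Suc)
qed simp_all

lemma nth_snoc_hd:
  assumes "i < length js"
  shows "(js @ [hd js]) ! i = js ! i" "(js @ [hd js]) ! Suc i = js ! (Suc i mod length js)"
proof -
  have "js \<noteq> []"
    using assms by auto
  with assms show "(js @ [hd js]) ! i = js ! i" "(js @ [hd js]) ! Suc i = js ! (Suc i mod length js)"
    by (auto simp: nth_append hd_conv_nth not_less less_Suc_eq_le le_Suc_eq mod_Suc)
qed

lemma cycle_prod_eq_walk_prod: "cycle_prod g js = walk_prod g (js @ [hd js])"
  unfolding cycle_prod_def walk_prod_conv_nth
  by (intro arg_cong [where f = prod_list] map_cong) (simp_all add: nth_snoc_hd del: upt_Suc)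

lemma is_cycle_iff_walk:
  "is_cycle E js \<longleftrightarrow> 3 \<le> length js \<and> distinct js \<and> walk E (js @ [hd js])"
  by (auto simp: is_cycle_def successively_conv_nth nth_snoc_hd)

lemma rtrancl_imp_walk:
  assumes "(i, j) \<in> E\<^sup>*"
  shows "\<exists>w. w \<noteq> [] \<and> walk E w \<and> hd w = i \<and> last w = j"
  using assms
proof (induction rule: rtrancl_induct)
  case base
  show ?case
    by (rule exI [of _ "[i]"]) simp
next
  case (step j k)
  then obtain w where "w \<noteq> []" "walk E w" "hd w = i" "last w = j"
    by blast
  with step.hyps show ?case
    by (intro exI [of _ "w @ [k]"]) (simp add: successively_append_iff)
qed

lemma walk_rev: "sym E \<Longrightarrow> walk E (rev w) \<longleftrightarrow> walk E w"
  by (auto simp: successively_rev sym_conv_converse_eq elim!: successively_mono dest: symD)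

text \<open>The factors \<open>g y x\<close> and \<open>g x y\<close> meet in the middle and cancel,
  from the inside outwards. In a monoid this makes the reversed walk a left inverse.\<close>

lemma walk_prod_rev:
  assumes "\<And>i j. (i, j) \<in> E \<Longrightarrow> g j i * g i j = 1" and "walk E w"
  shows "walk_prod g (rev w) * walk_prod g w = 1"
  using assms(2)
proof (induction w rule: induct_list012)
  case (3 x y w)
  have "walk_prod g (rev (x # y # w)) * walk_prod g (x # y # w) =
      walk_prod g (rev (y # w)) * (g y x * g x y) * walk_prod g (y # w)"
    using walk_prod_append [of g "rev w" y "[x]"] by (simp add: mult.assoc)
  also have "\<dots> = 1"
    using 3 assms(1) by simp
  finally show ?case .
qed simp_all

lemma closed_walk_prod:
  assumes irrefl: "irrefl E"
    and backtrack: "\<And>i j. (i, j) \<in> E \<Longrightarrow> g i j * g j i = 1"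
    and cycles: "\<And>js. is_cycle E js \<Longrightarrow> cycle_prod g js = 1"
    and "walk E w" "w \<noteq> []" "hd w = last w"
  shows "walk_prod g w = 1"
  using assms(4-6)
proof (induction w rule: length_induct)
  case (1 w)
  \<comment> \<open>Without its final node, the closed walk has distinct entries exactly when it
    meets no node twice except at its ends.\<close>
  define js where "js = butlast w"
  have w: "w = js @ [last w]"
    using "1.prems" by (simp add: js_def)
  show ?case
  proof (cases "distinct js")
    case True
    have hd_js: "last w = hd js" if "js \<noteq> []"
      using "1.prems" w that by (metis hd_append2)
    \<comment> \<open>The lengths below 3, which \<open>is_cycle\<close> excludes: a trivial walk, a
      loop ruled out by irreflexivity, and an edge traversed back and forth.\<close>
    consider "js = []" | x where "js = [x]" | x y where "js = [x, y]" | "3 \<le> length js"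
      by (cases js rule: remdups_adj.cases; cases "tl (tl js)") auto
    then show ?thesis
    proof cases
      case 1
      with w show ?thesis
        by (metis append_Nil walk_prod.simps(3))
    next
      case 2
      with w hd_js have "w = [x, x]"
        by simp
      with "1.prems" irrefl show ?thesis
        by (auto simp: irrefl_def)
    next
      case 3
      with w hd_js have "w = [x, y, x]"
        by simp
      with "1.prems" backtrack show ?thesis
        by simp
    next
      case 4
      then have eq: "w = js @ [hd js]"
        using w hd_js by fastforce
      then have "is_cycle E js"
        using 4 True "1.prems" by (metis is_cycle_iff_walk)
      then show ?thesis
        using cycles cycle_prod_eq_walk_prod eq by metis
    qed
  next
    case False
    then obtain u x v t where "js = u @ [x] @ v @ [x] @ t"
      using not_distinct_decomp by blast
    \<comment> \<open>\<open>s\<close> ends with the final node of \<open>w\<close>, so it is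
      nonempty; hence the inner walk \<open>x # v @ [x]\<close> is strictly shorter than
      \<open>w\<close> even if \<open>u\<close> is empty.\<close>
    then obtain s where s: "w = u @ x # v @ x # s" "s \<noteq> []"
      using w by auto
    have walks: "walk E (u @ [x])" "walk E (x # v @ [x])" "walk E (x # s)"
      using "1.prems"(1) walk_append [of E u x "v @ x # s"] walk_append [of E "x # v" x s] s
      by simp_all
    have inner: "walk_prod g (x # v @ [x]) = 1"
      using "1.IH" walks s by simp
    have "walk E (u @ x # s)"
      using walks walk_append by metis
    moreover have "hd (u @ x # s) = last (u @ x # s)"
      using "1.prems" s by (cases u) simp_all
    ultimately have outer: "walk_prod g (u @ x # s) = 1"
      using "1.IH" s by simp
    have "walk_prod g w = walk_prod g (u @ [x]) * walk_prod g (x # v @ [x]) * walk_prod g (x # s)"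
      using walk_prod_append [of g u x "v @ x # s"] walk_prod_append [of g "x # v" x s] s
      by (simp add: mult.assoc)
    also have "\<dots> = walk_prod g (u @ x # s)"
      using inner walk_prod_append [of g u x s] by simp
    finally show ?thesis
      using outer by simp
  qed
qed

text \<open>\<open>p\<close> acts as a potential, so the product telescopes; no inverses
  enter.\<close>

lemma walk_prod_potential:
  assumes "walk E w" "w \<noteq> []" and "\<And>i j. (i, j) \<in> E \<Longrightarrow> p i * g i j = p j"
  shows "p (hd w) * walk_prod g w = p (last w)"
  using assms(1,2)
proof (induction w rule: induct_list012)
  case (3 x y w)
  then show ?case
    using assms(3) by (simp flip: mult.assoc)
qed simp_all

section \<open>Unit dual quaternions\<close>

lemma qconj_mult: "qconj (x * y) = qconj y * qconj x"
  by (simp add: quat_eq_iff times_quat_def)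

lemma qconj_add: "qconj (x + y) = qconj x + qconj y"
  by (simp add: quat_eq_iff)

lemma qconj_qconj [simp]: "qconj (qconj x) = x"
  by (simp add: quat_eq_iff)

lemma mult_qconj: "x * qconj x = of_real ((norm x)\<^sup>2)" "qconj x * x = of_real ((norm x)\<^sup>2)"
  by (simp_all add: quat_eq_iff of_real_quat times_quat_def power2_norm_eq_inner inner_quat_def)

lemma qconj_zero [simp]: "qconj 0 = 0" and qconj_one [simp]: "qconj 1 = 1"
  by (simp_all add: quat_eq_iff one_quat_def)

lemma dqconj_mult: "dqconj (p * q) = dqconj q * dqconj p"
  by (simp add: dqconj_def times_dual_def qconj_mult qconj_add add.commute)

lemma dqconj_dqconj [simp]: "dqconj (dqconj q) = q"
  by (simp add: dqconj_def)

text \<open>The two parts of \<open>q * dqconj q\<close> are the squared norm of the standard part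
  and the numerator in the dual part of the magnitude. Closure under products thus becomes ring
  algebra.\<close>

lemma unit_dq_iff_mult_dqconj: "q \<in> unit_dq \<longleftrightarrow> q * dqconj q = 1"
proof -
  have "of_real ((norm x)\<^sup>2) = (1 :: quat) \<longleftrightarrow> norm x = 1" for x :: quat
    by (metis norm_ge_zero of_real_eq_1_iff one_power2 power2_eq_1_iff abs_norm_cancel
        real_sqrt_abs real_sqrt_one)
  then show ?thesis
    by (simp add: unit_dq_iff dqconj_def times_dual_def one_dual_def mult_qconj del: of_real_power)
qed

lemma unit_dq_mult_dqconj: "q \<in> unit_dq \<Longrightarrow> q * dqconj q = 1"
  by (simp add: unit_dq_iff_mult_dqconj)

lemma unit_dq_dqconj_mult:
  assumes "q \<in> unit_dq"
  shows "dqconj q * q = 1"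
proof -
  define a b where "a = std_part q" and "b = dual_part q"
  have "norm a = 1" and ab: "a * qconj b + b * qconj a = 0"
    using assms by (simp_all add: unit_dq_iff a_def b_def)
  then have a: "qconj a * a = 1"
    by (simp add: mult_qconj)
  \<comment> \<open>Inserting \<open>qconj a * a = 1\<close> after one term and before the other
    exhibits the dual part of \<open>dqconj q * q\<close> as the vanishing sum \<open>ab\<close>
    multiplied by \<open>qconj a\<close> on the left and \<open>a\<close> on the right.\<close>
  have "qconj a * b + qconj b * a =
      qconj a * b * (qconj a * a) + (qconj a * a) * qconj b * a"
    by (simp add: a)
  also have "\<dots> = qconj a * (a * qconj b + b * qconj a) * a"
    by (simp add: algebra_simps)
  finally have "qconj a * b + qconj b * a = 0"
    by (simp add: ab)
  then show ?thesis
    using a by (simp add: dqconj_def times_dual_def one_dual_def a_def b_def)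
qed

lemma unit_dq_dqconj: "q \<in> unit_dq \<Longrightarrow> dqconj q \<in> unit_dq"
  by (simp add: unit_dq_iff_mult_dqconj [of "dqconj q"] unit_dq_dqconj_mult)

lemma unit_dq_one: "1 \<in> unit_dq"
  by (simp add: unit_dq_iff one_dual_def)

lemma unit_dq_mult:
  assumes "p \<in> unit_dq" "q \<in> unit_dq"
  shows "p * q \<in> unit_dq"
proof -
  have "p * q * dqconj (p * q) = p * (q * dqconj q) * dqconj p"
    by (simp add: dqconj_mult mult.assoc)
  then show ?thesis
    using assms by (simp add: unit_dq_iff_mult_dqconj)
qed

lemma unit_dq_eq_dqconj_mult_iff: "p \<in> unit_dq \<Longrightarrow> g = dqconj p * q \<longleftrightarrow> p * g = q"
  by (metis mult.assoc mult_1 unit_dq_mult_dqconj unit_dq_dqconj_mult)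

lemma unit_dq_walk_prod:
  assumes "walk E w" and "\<And>i j. (i, j) \<in> E \<Longrightarrow> g i j \<in> unit_dq"
  shows "walk_prod g w \<in> unit_dq"
  using assms(1)
  by (induction w rule: induct_list012) (simp_all add: unit_dq_one unit_dq_mult assms(2))

section \<open>Desired formations\<close>

text \<open>In this form a desired formation is a potential for \<open>qd\<close>, as
  \<open>walk_prod_potential\<close> requires.\<close>

lemma desired_formations_iff:
  "q \<in> desired_formations E qd \<longleftrightarrow>
     (\<forall>i. q $ i \<in> unit_dq) \<and> (\<forall>i j. (i, j) \<in> E \<longrightarrow> q $ i * qd i j = q $ j)"
  by (auto simp: desired_formations_def unit_dq_eq_dqconj_mult_iff)

text \<open>By symmetry the formation constrains both directions of an edge. Around a cycle the
  potential returns to its initial value, a unit that cancels.\<close>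

lemma reasonable_imp:
  assumes "sym E" "reasonable E qd"
  shows "(i, j) \<in> E \<Longrightarrow> qd j i = dqconj (qd i j)"
    and "is_cycle E js \<Longrightarrow> cycle_prod qd js = 1"
proof -
  obtain q where q: "q \<in> desired_formations E qd"
    using assms by (auto simp: reasonable_def)
  show "qd j i = dqconj (qd i j)" if "(i, j) \<in> E"
  proof -
    have "qd i j = dqconj (q $ i) * q $ j" "qd j i = dqconj (q $ j) * q $ i"
      using q that symD [OF assms(1) that] by (auto simp: desired_formations_def)
    then show ?thesis
      by (simp add: dqconj_mult)
  qed
  show "cycle_prod qd js = 1" if "is_cycle E js"
  proof -
    let ?w = "js @ [hd js]"
    have "js \<noteq> []" "walk E ?w"
      using that by (auto simp: is_cycle_iff_walk)
    then have "q $ hd js * walk_prod qd ?w = q $ hd js"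
      using walk_prod_potential [of E ?w "\<lambda>i. q $ i" qd] q
      by (simp add: desired_formations_iff)
    then have "walk_prod qd ?w = dqconj (q $ hd js) * q $ hd js"
      using q by (subst unit_dq_eq_dqconj_mult_iff) (simp_all add: desired_formations_iff)
    then show ?thesis
      using q by (simp add: cycle_prod_eq_walk_prod desired_formations_iff unit_dq_dqconj_mult)
  qed
qed

lemma reasonable_if:
  fixes E :: "('n::finite \<times> 'n) set"
  assumes irrefl: "irrefl E" and sym: "sym E"
    and connected: "\<And>i j. (i, j) \<in> E\<^sup>*"
    and units: "\<And>i j. (i, j) \<in> E \<Longrightarrow> qd i j \<in> unit_dq"
    and conj: "\<And>i j. (i, j) \<in> E \<Longrightarrow> qd j i = dqconj (qd i j)"
    and cycles: "\<And>js. is_cycle E js \<Longrightarrow> cycle_prod qd js = 1"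
  shows "reasonable E qd"
proof -
  fix r :: 'n
  have backtrack: "qd i j * qd j i = 1" "qd j i * qd i j = 1" if "(i, j) \<in> E" for i j
    using that by (simp_all add: conj units unit_dq_mult_dqconj unit_dq_dqconj_mult)
  obtain P where P: "\<And>j. P j \<noteq> []" "\<And>j. walk E (P j)" "\<And>j. hd (P j) = r" "\<And>j. last (P j) = j"
    using rtrancl_imp_walk [OF connected [of r]] by metis
  define p where "p j = walk_prod qd (P j)" for j
  have "p i * qd i j = p j" if "(i, j) \<in> E" for i j
  proof -
    \<comment> \<open>Splitting off \<open>i\<close> and \<open>j\<close> lets the two paths be
      joined by the edge into a closed walk from \<open>r\<close> via \<open>i\<close> and
      \<open>j\<close> back to \<open>r\<close>.\<close>
    define u v where "u = butlast (P i)" and "v = tl (rev (P j))"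
    have u: "P i = u @ [i]"
      using P by (metis append_butlast_last_id u_def)
    have v: "rev (P j) = j # v"
      using P by (metis hd_Cons_tl hd_rev rev_is_Nil_conv v_def)
    let ?w = "u @ i # j # v"
    have "walk E (u @ [i])" "walk E (j # v)"
      using P(2) walk_rev [OF sym] u v by metis+
    then have "walk E ?w"
      using that walk_append [of E u i "j # v"] by simp
    moreover have "hd ?w = r"
      using P(3) [of i] u by (cases u) simp_all
    moreover have "last ?w = r"
      using P(3) [of j] v P(1) [of j] last_rev [of "P j"] by simp
    ultimately have "walk_prod qd ?w = 1"
      using irrefl backtrack(1) cycles by (intro closed_walk_prod [of E]) simp_all
    then have "p i * qd i j * walk_prod qd (rev (P j)) = 1"
      using walk_prod_append [of qd u i "j # v"] u v by (simp add: p_def mult.assoc)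
    moreover have "walk_prod qd (rev (P j)) * p j = 1"
      unfolding p_def using backtrack(2) P(2) by (rule walk_prod_rev)
    \<comment> \<open>A left inverse and a right inverse of the same element coincide.\<close>
    ultimately show ?thesis
      using mult.assoc [of "p i * qd i j" "walk_prod qd (rev (P j))" "p j"] by simp
  qed
  moreover have "p i \<in> unit_dq" for i
    unfolding p_def using P(2) units by (rule unit_dq_walk_prod)
  ultimately have "(\<chi> i. p i) \<in> desired_formations E qd"
    by (simp add: desired_formations_iff)
  then show ?thesis
    by (auto simp: reasonable_def)
qed

text \<open>Along an edge both formations gain the same right factor \<open>qd i j\<close>, which
  cancels in \<open>q $ i * dqconj (q0 $ i)\<close>; the value at any root serves as
  \<open>c\<close>. Conversely, left multiplication by \<open>c\<close> preserves the relations by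
  associativity.\<close>

lemma desired_formations_eq_orbit:
  fixes E :: "('n::finite \<times> 'n) set"
  assumes connected: "\<And>i j. (i, j) \<in> E\<^sup>*"
    and units: "\<And>i j. (i, j) \<in> E \<Longrightarrow> qd i j \<in> unit_dq"
    and q0: "q0 \<in> desired_formations E qd"
  shows "desired_formations E qd = {c *s q0 | c. c \<in> unit_dq}"
proof (intro equalityI subsetI)
  fix q assume q: "q \<in> desired_formations E qd"
  fix r :: 'n
  let ?c = "\<lambda>i. q $ i * dqconj (q0 $ i)"
  have const: "?c i = ?c r" for i
    using connected [of r i]
  proof (induction rule: rtrancl_induct)
    case (step i j)
    have "q $ j = q $ i * qd i j" "q0 $ j = q0 $ i * qd i j"
      using q q0 step.hyps by (auto simp: desired_formations_iff)
    then have "?c j = q $ i * (qd i j * dqconj (qd i j)) * dqconj (q0 $ i)"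
      by (simp add: dqconj_mult mult.assoc)
    then show ?case
      using units [OF step.hyps(2)] step.IH by (simp add: unit_dq_mult_dqconj)
  qed simp
  have "q $ i = ?c r * q0 $ i" for i
  proof -
    have "?c r * q0 $ i = ?c i * q0 $ i"
      by (simp only: const [of i])
    also have "\<dots> = q $ i"
      using q0 by (simp add: desired_formations_iff mult.assoc unit_dq_dqconj_mult)
    finally show ?thesis ..
  qed
  then have "q = ?c r *s q0"
    unfolding vec_eq_iff vector_smult_component by blast
  moreover have "?c r \<in> unit_dq"
    using q q0 by (simp add: desired_formations_iff unit_dq_mult unit_dq_dqconj)
  ultimately show "q \<in> {c *s q0 | c. c \<in> unit_dq}"
    by blast
qed (use q0 in \<open>auto simp: desired_formations_iff unit_dq_mult mult.assoc\<close>)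

theorem theorem5p1:
  fixes E :: "('n::finite \<times> 'n) set"
    and qd :: "'n \<Rightarrow> 'n \<Rightarrow> quat dual"
  assumes distinct_ends: "irrefl E"
    and bidirectional: "sym E"
    and connected: "\<And>i j. i \<noteq> j \<Longrightarrow> (i, j) \<in> E\<^sup>+"
    and units: "\<And>i j. (i, j) \<in> E \<Longrightarrow> qd i j \<in> unit_dq"
  shows "(reasonable E qd \<longleftrightarrow>
            (\<forall>(i, j)\<in>E. qd j i = dqconj (qd i j)) \<and>
            (\<forall>js. is_cycle E js \<longrightarrow> cycle_prod qd js = 1)) \<and>
         (\<forall>q0 \<in> desired_formations E qd.
            desired_formations E qd = {c *s q0 | c. c \<in> unit_dq})"
proof -
  \<comment> \<open>Connectedness is stated for distinct nodes; reflexivity supplies the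
    diagonal.\<close>
  have reachable: "(i, j) \<in> E\<^sup>*" for i j
    using connected [of i j] by (cases "i = j") auto
  show ?thesis
    using reasonable_imp [OF bidirectional, of qd]
      reasonable_if [where qd = qd, OF distinct_ends bidirectional reachable units]
      desired_formations_eq_orbit [where qd = qd, OF reachable units]
    by blast
qed

end
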